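(* Let $q$ be an odd prime power with $q\equiv 1\pmod 4$, and let $A$ be an integer with $q+1-A\equiv 0\pmod 8$. Then there exists a bijection between the sets $N_{2n4}(A)$ and $N_{n2}(A)$.
   Context: For $d\in\mathbb{F}_q\setminus\{0,1\}$, let $L_d$ be the Legendre curve $y^2=x(x-1)(x-d)$ over $\mathbb{F}_q$ and $A(d,\mathbb{F}_q)=q+1-\#L_d(\mathbb{F}_q)$. For an integer $A$, $N_{2n4}(A)$ denotes the set of $d\in\mathbb{F}_q\setminus\{0,1\}$ with $A(d,\mathbb{F}_q)=A$ that are squares but not fourth powers in $\mathbb{F}_q$, and $N_{n2}(A)$ the set of $d\in\mathbb{F}_q\setminus\{0,1\}$ with $A(d,\mathbb{F}_q)=A$ that are non-squares in $\mathbb{F}_q$. *)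

theory Defs
  imports "HOL-Number_Theory.Number_Theory" "HOL-Computational_Algebra.Nth_Powers" "HOL-Library.Cardinality"
begin

(* The projective closure of y^2 = x(x-1)(x-d) has exactly one point on the line at
   infinity, and it is rational over every base field; None stands for that point. *)
definition legendre_curve :: "'a::field \<Rightarrow> ('a \<times> 'a) option set" where
  "legendre_curve d =
     insert None (Some ` {(x, y). y ^ 2 = x * (x - 1) * (x - d)})"

definition legendre_trace :: "'a::finite_field \<Rightarrow> int" where
  "legendre_trace d = int CARD('a) + 1 - int (card (legendre_curve d))"

definition N2n4 :: "int \<Rightarrow> 'a::finite_field set" where
  "N2n4 A = {d. d \<notin> {0, 1} \<and> legendre_trace d = A
                \<and> is_square d \<and> \<not> is_nth_power 4 d}"

definition Nn2 :: "int \<Rightarrow> 'a::finite_field set" where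
  "Nn2 A = {d. d \<notin> {0, 1} \<and> legendre_trace d = A \<and> \<not> is_square d}"

end

theory Submission
  imports Defs
begin

text \<open>Point counts are compared through the sums of the quadratic character over \<open>x(x-1)(x-d)\<close>.
  If \<open>d\<close> is a non-square and \<open>8\<close> divides \<open>#L\<^sub>d\<close>, then \<open>1 - d\<close> is a square, so \<open>d \<mapsto> 1 - d\<close>
  identifies \<open>N\<^sub>n\<^sub>2(A)\<close> with the set of those \<open>d = e\<^sup>2\<close> of trace \<open>A\<close> for which \<open>1 - e\<^sup>2\<close> is a
  non-square. The 2-isogeny with kernel \<open>\<langle>(0, 0)\<rangle>\<close> preserves the trace and takes \<open>e\<^sup>2\<close> to
  \<open>g\<^sup>2\<close>, where \<open>g = (1 - e)/(1 + e)\<close>; as \<open>1 - e\<^sup>2 = (1 + e)\<^sup>2 g\<close>, the condition on \<open>e\<close> says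
  that \<open>g\<close> is a non-square, that is (\<open>-1\<close> being a square), that \<open>g\<^sup>2\<close> is not a fourth power.
  The map \<open>e \<mapsto> g\<close> is an involution, and both sets of roots cover their sets of squares
  two to one, so the cardinalities agree.\<close>

section \<open>Counting by classes and involutions\<close>

text \<open>Two classes with a common element coincide by the last assumption, so the sets
  \<open>c x\<close> partition \<open>X\<close> into blocks of size \<open>k\<close>.\<close>

lemma dvd_card_if_class_card:
  assumes "finite X"
    and "\<And>x. x \<in> X \<Longrightarrow> x \<in> c x \<and> c x \<subseteq> X \<and> card (c x) = k"
    and "\<And>x y. x \<in> X \<Longrightarrow> y \<in> c x \<Longrightarrow> c y = c x"
  shows "k dvd card X"
proof -
  have U: "\<Union> (c ` X) = X"
    using assms(2) by blast
  have "k dvd card (\<Union> (c ` X))"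
  proof (rule dvd_partition)
    show "finite (\<Union> (c ` X))"
      unfolding U by (rule assms(1))
    show "\<forall>s\<in>c ` X. k dvd card s"
      using assms(2) by auto
    show "\<forall>s1\<in>c ` X. \<forall>s2\<in>c ` X. s1 \<noteq> s2 \<longrightarrow> s1 \<inter> s2 = {}"
      using assms(3) by blast
  qed
  then show ?thesis
    by (simp only: U)
qed

lemma even_card_if_involution:
  assumes "finite X"
    and "\<And>x. x \<in> X \<Longrightarrow> f x \<in> X \<and> f x \<noteq> x \<and> f (f x) = x"
  shows "even (card X)"
proof (rule dvd_card_if_class_card[where c = "\<lambda>x. {x, f x}"])
  show "x \<in> {x, f x} \<and> {x, f x} \<subseteq> X \<and> card {x, f x} = 2" if "x \<in> X" for x
  proof -
    have "f x \<in> X" "x \<noteq> f x"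
      using assms(2)[OF that] by auto
    then show ?thesis
      using that by simp
  qed
  show "{y, f y} = {x, f x}" if "x \<in> X" "y \<in> {x, f x}" for x y
  proof -
    have "f (f x) = x"
      using assms(2)[OF that(1)] by simp
    then show ?thesis
      using that(2) by auto
  qed
qed (rule assms(1))

section \<open>Squares in finite fields of odd order\<close>

text \<open>In characteristic 2, translation by 1 would be a fixed-point-free involution of the
  field.\<close>

lemma two_neq_zero:
  assumes "odd CARD('a::finite_field)"
  shows "(2::'a) \<noteq> 0"
proof
  assume "(2::'a) = 0"
  then have "x + 1 + 1 = x" for x :: 'a
    by (simp add: add.assoc)
  then have "even CARD('a)"
    by (intro even_card_if_involution[where f = "\<lambda>x. x + 1"]) auto
  then show False
    using assms by simp
qed

lemma is_square_iff: "is_square x \<longleftrightarrow> (\<exists>y. x = y\<^sup>2)"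
  by (auto simp: is_nth_power_def)

lemma is_square_cancel_left:
  fixes x y :: "'a::field"
  assumes "is_square x" "x \<noteq> 0"
  shows "is_square (x * y) \<longleftrightarrow> is_square y"
proof
  assume "is_square (x * y)"
  then obtain u v where "x = u\<^sup>2" "x * y = v\<^sup>2"
    using assms by (auto simp: is_square_iff)
  then have "y = (v / u)\<^sup>2"
    using assms by (auto simp: field_simps)
  then show "is_square y"
    by (auto simp: is_square_iff)
qed (use assms in \<open>auto intro: is_nth_power_mult\<close>)

lemma card_square_roots:
  fixes x :: "'a::finite_field"
  assumes "odd CARD('a)" "is_square x" "x \<noteq> 0"
  shows "card {y. y\<^sup>2 = x} = 2"
proof -
  obtain z where z: "x = z\<^sup>2"
    using assms by (auto simp: is_square_iff)
  have "z \<noteq> - z"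
    using two_neq_zero[OF assms(1)] assms(3) z
    by (metis add_eq_0_iff mult_2 mult_eq_0_iff zero_power2)
  moreover have "{y. y\<^sup>2 = x} = {z, - z}"
    using z by (auto simp: power2_eq_iff)
  ultimately show ?thesis
    by simp
qed

lemma card_nonzero_squares:
  assumes "odd CARD('a::finite_field)"
  shows "2 * card {x::'a. x \<noteq> 0 \<and> is_square x} = CARD('a) - 1"
proof -
  let ?Q = "{x::'a. x \<noteq> 0 \<and> is_square x}"
  have "CARD('a) - 1 = card (UNIV - {0::'a})"
    by (simp add: card_Diff_subset)
  also have "UNIV - {0::'a} = (\<Union>x\<in>?Q. {y. y\<^sup>2 = x})"
    by (auto simp: is_square_iff)
  also have "card \<dots> = (\<Sum>x\<in>?Q. card {y. y\<^sup>2 = x})"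
    by (rule card_UN_disjoint) auto
  also have "\<dots> = (\<Sum>x\<in>?Q. 2)"
    by (rule sum.cong) (auto simp: card_square_roots[OF assms])
  finally show ?thesis
    by simp
qed

text \<open>Exactly half of the nonzero elements are squares, so the nonzero squares
  \<open>?Q\<close> and their multiples by \<open>a\<close> exhaust the nonzero elements. Hence
  \<open>b\<close> is \<open>a\<close> times a square.\<close>

lemma is_square_mult_nonsquares:
  fixes a b :: "'a::finite_field"
  assumes "odd CARD('a)" "\<not> is_square a" "\<not> is_square b"
  shows "is_square (a * b)"
proof -
  let ?Q = "{x::'a. x \<noteq> 0 \<and> is_square x}"
  have a0: "a \<noteq> 0" and b0: "b \<noteq> 0"
    using assms by auto
  have disj: "?Q \<inter> (*) a ` ?Q = {}"
    using assms(2) is_square_cancel_left by (auto simp: mult.commute)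
  have "card ((*) a ` ?Q) = card ?Q"
    using a0 by (intro card_image) (auto simp: inj_on_def)
  then have "card (?Q \<union> (*) a ` ?Q) = card (UNIV - {0::'a})"
    using card_nonzero_squares[OF assms(1)] disj
    by (simp add: card_Un_disjoint card_Diff_subset)
  moreover have "?Q \<union> (*) a ` ?Q \<subseteq> UNIV - {0}"
    using a0 by auto
  ultimately have "?Q \<union> (*) a ` ?Q = UNIV - {0}"
    by (intro card_subset_eq) auto
  then obtain s where "b = a * s" "is_square s"
    using assms(3) b0 by (metis (mono_tags, lifting) DiffI UNIV_I UnE imageE mem_Collect_eq singletonD)
  then have "a * b = a\<^sup>2 * s"
    by (simp add: power2_eq_square)
  then show ?thesis
    using \<open>is_square s\<close> by (auto intro: is_nth_power_mult)
qed

text \<open>If -1 were a non-square, inversion would have no fixed point on the nonzero squares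
  other than 1. The number of nonzero squares, half of \<open>CARD('a) - 1\<close>, would then be
  odd.\<close>

lemma is_square_uminus_one:
  assumes "[CARD('a::finite_field) = 1] (mod 4)"
  shows "is_square (- 1 :: 'a)"
proof (rule ccontr)
  assume nsq: "\<not> is_square (- 1 :: 'a)"
  let ?Q = "{x::'a. x \<noteq> 0 \<and> is_square x}"
  have mod4: "CARD('a) mod 4 = 1"
    using assms by (simp add: cong_def)
  have "odd CARD('a)"
    using mod4 by presburger
  then have card: "2 * card ?Q = CARD('a) - 1"
    by (rule card_nonzero_squares)
  have "even (card (?Q - {1}))"
  proof (rule even_card_if_involution[where f = inverse])
    fix x :: 'a
    assume x: "x \<in> ?Q - {1}"
    then obtain y where y: "x = y\<^sup>2" "y \<noteq> 0"
      by (auto simp: is_square_iff)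
    have "inverse x = (inverse y)\<^sup>2"
      using y by (simp add: power_inverse)
    then have "is_square (inverse x)"
      by (auto simp: is_square_iff)
    moreover have "inverse x \<noteq> x"
    proof
      assume "inverse x = x"
      then have "x\<^sup>2 = inverse x * x"
        by (simp add: power2_eq_square)
      then have "x\<^sup>2 = 1"
        using x by simp
      then show False
        using x nsq by (auto simp: power2_eq_1_iff)
    qed
    moreover have "inverse x \<noteq> 1"
      using x by simp
    ultimately show "inverse x \<in> ?Q - {1} \<and> inverse x \<noteq> x \<and> inverse (inverse x) = x"
      using x by auto
  qed simp
  moreover have "card ?Q = Suc (card (?Q - {1}))"
    by (intro card.remove) auto
  ultimately show False
    using card mod4 by presburger
qed

section \<open>The quadratic character and point counts\<close>

text \<open>Zero is tested first because \<open>is_square 0\<close> holds. With the value 0 there,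
  \<open>1 + quad_char x\<close> is the number of square roots of \<open>x\<close> for every
  \<open>x\<close>.\<close>

definition quad_char :: "'a::finite_field \<Rightarrow> int" where
  "quad_char x = (if x = 0 then 0 else if is_square x then 1 else - 1)"

lemma quad_char_0 [simp]: "quad_char 0 = 0"
  by (simp add: quad_char_def)

lemma quad_char_mult_square:
  "is_square x \<Longrightarrow> x \<noteq> 0 \<Longrightarrow> quad_char (x * y) = quad_char y"
  by (simp add: quad_char_def is_square_cancel_left)

lemma quad_char_mult:
  fixes x y :: "'a::finite_field"
  assumes "odd CARD('a)"
  shows "quad_char (x * y) = quad_char x * quad_char y"
  using is_square_cancel_left[of x y] is_square_cancel_left[of y x]
    is_square_mult_nonsquares[OF assms, of x y]
  by (auto simp: quad_char_def mult.commute)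

lemma card_square_roots_quad_char:
  fixes x :: "'a::finite_field"
  assumes "odd CARD('a)"
  shows "int (card {y. y\<^sup>2 = x}) = 1 + quad_char x"
proof (cases "x \<noteq> 0 \<and> \<not> is_square x")
  case True
  then have "{y. y\<^sup>2 = x} = {}"
    by (auto simp: is_square_iff)
  then show ?thesis
    using True by (simp add: quad_char_def)
qed (use card_square_roots[OF assms] in \<open>auto simp: quad_char_def\<close>)

lemma sum_quad_char:
  assumes "odd CARD('a::finite_field)"
  shows "(\<Sum>x\<in>UNIV. quad_char (x::'a)) = 0"
proof -
  have "int CARD('a) = int (card (\<Union>x::'a. {y. y\<^sup>2 = x}))"
    by (intro arg_cong[where f = "\<lambda>S. int (card S)"]) auto
  also have "\<dots> = (\<Sum>x::'a\<in>UNIV. int (card {y. y\<^sup>2 = x}))"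
    by (subst card_UN_disjoint) auto
  also have "\<dots> = int CARD('a) + (\<Sum>x\<in>UNIV. quad_char (x::'a))"
    by (simp add: card_square_roots_quad_char[OF assms] sum.distrib)
  finally show ?thesis
    by simp
qed

text \<open>Each \<open>x\<close> carries \<open>1 + quad_char\<close> affine points; the summands 1
  and the point at infinity cancel against \<open>CARD('a) + 1\<close>.\<close>

lemma legendre_trace_eq_sum:
  fixes d :: "'a::finite_field"
  assumes "odd CARD('a)"
  shows "legendre_trace d = - (\<Sum>x\<in>UNIV. quad_char (x * (x - 1) * (x - d)))"
proof -
  let ?E = "{(x, y). y\<^sup>2 = x * (x - 1) * (x - d)}"
  have "card (legendre_curve d) = Suc (card ?E)"
    unfolding legendre_curve_def
    by (subst card_insert_disjoint) (auto simp: card_image)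
  moreover have "?E = (SIGMA x:UNIV. {y. y\<^sup>2 = x * (x - 1) * (x - d)})"
    by auto
  then have "card ?E = (\<Sum>x\<in>UNIV. card {y. y\<^sup>2 = x * (x - 1) * (x - d)})"
    by simp
  ultimately show ?thesis
    by (simp add: legendre_trace_def card_square_roots_quad_char[OF assms] sum.distrib)
qed

text \<open>Completing the square: \<open>2 * x - t\<close> runs over the square roots of the
  discriminant. The equation is \<open>x + b / x = t\<close> cleared of its denominator.\<close>

lemma card_quadratic_roots:
  fixes t b :: "'a::finite_field"
  assumes "odd CARD('a)"
  shows "int (card {x. x\<^sup>2 + b = t * x}) = 1 + quad_char (t\<^sup>2 - 4 * b)"
proof -
  have two: "(2::'a) \<noteq> 0"
    by (rule two_neq_zero[OF assms])
  have "bij_betw (\<lambda>x. 2 * x - t) {x. x\<^sup>2 + b = t * x} {y. y\<^sup>2 = t\<^sup>2 - 4 * b}"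
  proof (rule bij_betwI[where g = "\<lambda>y. (y + t) / 2"])
    have "(2 * x - t)\<^sup>2 = t\<^sup>2 - 4 * b" if "x\<^sup>2 + b = t * x" for x
    proof -
      have "(2 * x - t)\<^sup>2 = t\<^sup>2 - 4 * b + 4 * (x\<^sup>2 + b - t * x)"
        by (simp add: power2_eq_square algebra_simps)
      then show ?thesis
        using that by simp
    qed
    then show "(\<lambda>x. 2 * x - t) \<in> {x. x\<^sup>2 + b = t * x} \<rightarrow> {y. y\<^sup>2 = t\<^sup>2 - 4 * b}"
      by blast
    have "((y + t) / 2)\<^sup>2 + b = t * ((y + t) / 2)" if "y\<^sup>2 = t\<^sup>2 - 4 * b" for y
    proof -
      define x where "x = (y + t) / 2"
      have "2 * x = y + t"
        using two by (simp add: x_def)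
      then have y: "y = 2 * x - t"
        by simp
      \<comment> \<open>The factor 4 is written as two factors 2, so that \<open>two\<close> cancels
        it.\<close>
      have "2 * (2 * (x\<^sup>2 + b - t * x)) = y\<^sup>2 - (t\<^sup>2 - 4 * b)"
        unfolding y by (simp add: power2_eq_square algebra_simps)
      then have "x\<^sup>2 + b - t * x = 0"
        using that two by (metis cancel_comm_monoid_add_class.diff_cancel mult_eq_0_iff)
      then show ?thesis
        by (simp add: x_def)
    qed
    then show "(\<lambda>y. (y + t) / 2) \<in> {y. y\<^sup>2 = t\<^sup>2 - 4 * b} \<rightarrow> {x. x\<^sup>2 + b = t * x}"
      by blast
  qed (use two in \<open>auto simp: field_simps\<close>)
  then show ?thesis
    by (simp add: bij_betw_same_card card_square_roots_quad_char[OF assms])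
qed

text \<open>The two sides count the points of \<open>y\<^sup>2 = x(x\<^sup>2 + ax + b)\<close> and of its quotient by the
  2-torsion point \<open>(0, 0)\<close>; the substitution \<open>t = x + b/x\<close> linearises the character sum.\<close>

lemma sum_quad_char_two_isogeny:
  fixes a b :: "'a::finite_field"
  assumes odd: "odd CARD('a)" and b: "b \<noteq> 0"
  shows "(\<Sum>x\<in>UNIV. quad_char (x * (x\<^sup>2 + a * x + b))) =
         (\<Sum>x\<in>UNIV. quad_char (x * (x\<^sup>2 - 2 * a * x + (a\<^sup>2 - 4 * b))))"
proof -
  have "(\<Sum>x\<in>UNIV. quad_char (x * (x\<^sup>2 + a * x + b))) =
        (\<Sum>x\<in>UNIV - {0}. quad_char (x * (x\<^sup>2 + a * x + b)))"
    by (rule sum.mono_neutral_right) auto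
  also have "\<dots> = (\<Sum>x\<in>UNIV - {0}. quad_char (x + b / x + a))"
  proof (rule sum.cong)
    fix x :: 'a
    assume "x \<in> UNIV - {0}"
    then have "x * (x\<^sup>2 + a * x + b) = x\<^sup>2 * (x + b / x + a)" and "x \<noteq> 0"
      by (auto simp: field_simps power2_eq_square)
    then show "quad_char (x * (x\<^sup>2 + a * x + b)) = quad_char (x + b / x + a)"
      by (simp add: quad_char_mult_square)
  qed simp
  \<comment> \<open>The summand depends only on \<open>t = x + b / x\<close>, so each
    \<open>t\<close> is weighted by the size of its fibre.\<close>
  also have "\<dots> = (\<Sum>t\<in>UNIV. \<Sum>x\<in>{x \<in> UNIV - {0}. x + b / x = t}. quad_char (x + b / x + a))"
    by (rule sum.group[symmetric]) auto
  also have "\<dots> = (\<Sum>t\<in>UNIV. (1 + quad_char (t\<^sup>2 - 4 * b)) * quad_char (t + a))"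
  proof (rule sum.cong)
    fix t :: 'a
    have "x \<noteq> 0 \<and> x + b / x = t \<longleftrightarrow> x\<^sup>2 + b = t * x" for x
      using b by (cases "x = 0") (auto simp: divide_simps power2_eq_square)
    then have "{x \<in> UNIV - {0}. x + b / x = t} = {x. x\<^sup>2 + b = t * x}"
      by auto
    then have "int (card {x \<in> UNIV - {0}. x + b / x = t}) = 1 + quad_char (t\<^sup>2 - 4 * b)"
      by (simp add: card_quadratic_roots[OF odd])
    moreover have "(\<Sum>x\<in>{x \<in> UNIV - {0}. x + b / x = t}. quad_char (x + b / x + a)) =
        (\<Sum>x\<in>{x \<in> UNIV - {0}. x + b / x = t}. quad_char (t + a))"
      by (rule sum.cong) auto
    ultimately show "(\<Sum>x\<in>{x \<in> UNIV - {0}. x + b / x = t}. quad_char (x + b / x + a)) =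
               (1 + quad_char (t\<^sup>2 - 4 * b)) * quad_char (t + a)"
      by simp
  qed simp
  \<comment> \<open>After this shift the constant part of the weight contributes a full character
    sum, which vanishes, and the other part gives the cubic of the quotient curve.\<close>
  also have "\<dots> = (\<Sum>x\<in>UNIV. (1 + quad_char ((x - a)\<^sup>2 - 4 * b)) * quad_char x)"
    by (rule sum.reindex_bij_witness[of _ "\<lambda>x. x - a" "\<lambda>t. t + a"]) auto
  also have "\<dots> = (\<Sum>x\<in>UNIV. quad_char (x::'a)) +
      (\<Sum>x\<in>UNIV. quad_char (x * (x\<^sup>2 - 2 * a * x + (a\<^sup>2 - 4 * b))))"
  proof -
    have "x * (x\<^sup>2 - 2 * a * x + (a\<^sup>2 - 4 * b)) = ((x - a)\<^sup>2 - 4 * b) * x" for x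
      by (simp add: power2_eq_square algebra_simps)
    then have "(1 + quad_char ((x - a)\<^sup>2 - 4 * b)) * quad_char x =
        quad_char x + quad_char (x * (x\<^sup>2 - 2 * a * x + (a\<^sup>2 - 4 * b)))" for x
      by (simp only: quad_char_mult[OF odd] distrib_right mult_1)
    then show ?thesis
      by (simp only: sum.distrib)
  qed
  finally show ?thesis
    by (simp add: sum_quad_char[OF odd])
qed

section \<open>Equalities between Legendre traces\<close>

text \<open>The substitution of \<open>1 - x\<close> for \<open>x\<close> multiplies the cubic by
  -1, which the character ignores when -1 is a square.\<close>

lemma legendre_trace_one_minus:
  fixes d :: "'a::finite_field"
  assumes odd: "odd CARD('a)" and "is_square (- 1 :: 'a)"
  shows "legendre_trace (1 - d) = legendre_trace d"
proof -
  have "(\<Sum>x\<in>UNIV. quad_char (x * (x - 1) * (x - (1 - d)))) =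
        (\<Sum>x\<in>UNIV. quad_char (- 1 * (x * (x - 1) * (x - d))))"
    by (rule sum.reindex_bij_witness[of _ "\<lambda>x. 1 - x" "\<lambda>x. 1 - x"])
      (auto simp: algebra_simps)
  also have "\<dots> = (\<Sum>x\<in>UNIV. quad_char (x * (x - 1) * (x - d)))"
    by (subst quad_char_mult_square) (use assms in auto)
  finally show ?thesis
    by (simp add: legendre_trace_eq_sum[OF odd])
qed

lemma legendre_trace_two_isogeny:
  fixes e :: "'a::finite_field"
  assumes odd: "odd CARD('a)" and sq: "is_square (- 1 :: 'a)" and e: "e \<noteq> 0" "1 + e \<noteq> 0"
  shows "legendre_trace (((1 - e) / (1 + e))\<^sup>2) = legendre_trace (e\<^sup>2)"
proof -
  define g where "g = (1 - e) / (1 + e)"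
  define s where "s = (1 + e)\<^sup>2"
  have s: "is_square s" "s \<noteq> 0"
    using e by (auto simp: s_def)
  have gs: "g\<^sup>2 * s = (1 - e)\<^sup>2"
    using e by (simp add: g_def s_def power_divide)
  let ?a = "- (1 + e\<^sup>2)"
  have "(\<Sum>x\<in>UNIV. quad_char (x * (x - 1) * (x - e\<^sup>2))) =
        (\<Sum>x\<in>UNIV. quad_char (x * (x\<^sup>2 + ?a * x + e\<^sup>2)))"
    by (intro sum.cong arg_cong[where f = quad_char]) (simp_all add: algebra_simps power2_eq_square)
  also have "\<dots> = (\<Sum>x\<in>UNIV. quad_char (x * (x\<^sup>2 - 2 * ?a * x + (?a\<^sup>2 - 4 * e\<^sup>2))))"
    by (rule sum_quad_char_two_isogeny[OF odd]) (use e in simp)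
  \<comment> \<open>The quotient cubic has the roots 0, \<open>- s\<close> and
    \<open>- s * g\<^sup>2\<close>. Scaling by \<open>- s\<close> moves them to 0, 1 and
    \<open>g\<^sup>2\<close>, at the cost of the factor \<open>- (s ^ 3)\<close>, which is a
    square.\<close>
  also have "\<dots> = (\<Sum>x\<in>UNIV. quad_char (- 1 * (s ^ 3 * (x * (x - 1) * (x - g\<^sup>2)))))"
  proof (rule sum.reindex_bij_witness[of _ "\<lambda>x. - s * x" "\<lambda>x. - x / s"])
    fix x :: 'a
    have "- 1 * (s ^ 3 * (- x / s * (- x / s - 1) * (- x / s - g\<^sup>2))) =
          x * (x + s) * (x + g\<^sup>2 * s)"
      using s by (simp add: field_simps power3_eq_cube)
    also have "\<dots> = x * (x\<^sup>2 - 2 * ?a * x + (?a\<^sup>2 - 4 * e\<^sup>2))"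
      unfolding gs unfolding s_def by (simp add: power2_eq_square algebra_simps)
    finally show "quad_char (- 1 * (s ^ 3 * (- x / s * (- x / s - 1) * (- x / s - g\<^sup>2)))) =
        quad_char (x * (x\<^sup>2 - 2 * ?a * x + (?a\<^sup>2 - 4 * e\<^sup>2)))"
      by simp
  qed (use s in auto)
  also have "\<dots> = (\<Sum>x\<in>UNIV. quad_char (x * (x - 1) * (x - g\<^sup>2)))"
  proof (rule sum.cong)
    fix x :: 'a
    have "is_square (s ^ 3)"
    proof -
      have "s ^ 3 = ((1 + e) ^ 3)\<^sup>2"
        by (simp add: s_def flip: power_mult)
      then show ?thesis
        unfolding is_square_iff by blast
    qed
    then have "quad_char (s ^ 3 * z) = quad_char z" for z
      by (rule quad_char_mult_square) (use s in simp)
    moreover have "quad_char (- 1 * z) = quad_char z" for z :: 'a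
      by (rule quad_char_mult_square[OF sq]) simp
    ultimately show "quad_char (- 1 * (s ^ 3 * (x * (x - 1) * (x - g\<^sup>2)))) =
        quad_char (x * (x - 1) * (x - g\<^sup>2))"
      by (simp only:)
  qed simp
  finally show ?thesis
    by (simp add: legendre_trace_eq_sum[OF odd] g_def)
qed

section \<open>The number of points modulo 8\<close>

text \<open>The points outside the 2-torsion come in pairs \<open>(x, \<plusminus>y)\<close>, and translation by the four
  2-torsion points acts on the set of their \<open>x\<close>-coordinates. If neither \<open>d\<close> nor \<open>1 - d\<close> is a
  square then this action is free.\<close>

lemma card_legendre_curve_mod_8:
  fixes d :: "'a::finite_field"
  assumes odd: "odd CARD('a)"
    and nsq: "\<not> is_square d" "\<not> is_square (1 - d)"
  shows "[int CARD('a) + 1 - legendre_trace d = 4] (mod 8)"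
proof -
  define f where "f x = x * (x - 1) * (x - d)" for x
  \<comment> \<open>The \<open>x\<close>-coordinates of the affine points with nonzero
    \<open>y\<close>.\<close>
  define X where "X = {x. f x \<noteq> 0 \<and> is_square (f x)}"
  \<comment> \<open>\<open>\<alpha>\<close>, \<open>\<beta>\<close> and \<open>\<gamma>\<close>
    describe translation by (0, 0), (1, 0) and (d, 0) on \<open>x\<close>-coordinates.\<close>
  define \<alpha> where "\<alpha> x = d / x" for x
  define \<beta> where "\<beta> x = (x - d) / (x - 1)" for x
  define \<gamma> where "\<gamma> x = d * (x - 1) / (x - d)" for x
  have d: "d \<noteq> 0" "d \<noteq> 1"
    using nsq by auto
  have X: "x \<noteq> 0 \<and> x \<noteq> 1 \<and> x \<noteq> d" if "x \<in> X" for x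
    using that by (auto simp: X_def f_def)
  have sq_mult: "x \<in> X \<Longrightarrow> f y = u\<^sup>2 * f x \<Longrightarrow> u \<noteq> 0 \<Longrightarrow> y \<in> X" for x y u
    by (auto simp: X_def intro: is_nth_power_mult)
  have \<alpha>_X: "\<alpha> x \<in> X" if "x \<in> X" for x
  proof (rule sq_mult[OF that, of _ "d / x\<^sup>2"])
    show "f (\<alpha> x) = (d / x\<^sup>2)\<^sup>2 * f x"
      using X[OF that] by (simp add: f_def \<alpha>_def divide_simps)
        (simp add: algebra_simps eval_nat_numeral)
  qed (use X[OF that] d in auto)
  have \<beta>_X: "\<beta> x \<in> X" if "x \<in> X" for x
  proof (rule sq_mult[OF that, of _ "(1 - d) / (x - 1)\<^sup>2"])
    show "f (\<beta> x) = ((1 - d) / (x - 1)\<^sup>2)\<^sup>2 * f x"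
      using X[OF that] by (simp add: f_def \<beta>_def divide_simps)
        (simp add: algebra_simps eval_nat_numeral)
  qed (use X[OF that] d in auto)
  have \<gamma>_eq: "\<gamma> x = \<alpha> (\<beta> x)" if "x \<in> X" for x
    using X[OF that] by (simp add: \<alpha>_def \<beta>_def \<gamma>_def)
  have \<gamma>_eq': "\<gamma> x = \<beta> (\<alpha> x)" if "x \<in> X" for x
    using X[OF that] by (simp add: \<alpha>_def \<beta>_def \<gamma>_def divide_simps)
        (simp add: algebra_simps)
  have \<gamma>_X: "\<gamma> x \<in> X" if "x \<in> X" for x
    using that by (simp add: \<gamma>_eq \<alpha>_X \<beta>_X)
  have \<alpha>_\<alpha>: "\<alpha> (\<alpha> x) = x" if "x \<in> X" for x
    using X[OF that] d by (simp add: \<alpha>_def)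
  have \<beta>_\<beta>: "\<beta> (\<beta> x) = x" if "x \<in> X" for x
    using X[OF that] d X[OF \<beta>_X[OF that]] by (simp add: \<beta>_def divide_simps)
        (simp add: algebra_simps)
  have \<alpha>_neq: "\<alpha> x \<noteq> x" if "x \<in> X" for x
  proof
    assume "\<alpha> x = x"
    then have "d = x\<^sup>2"
      using X[OF that] by (simp add: \<alpha>_def field_simps power2_eq_square)
    then show False
      using nsq by auto
  qed
  have \<beta>_neq: "\<beta> x \<noteq> x" if "x \<in> X" for x
  proof
    assume "\<beta> x = x"
    then have "x - d = x * (x - 1)"
      using X[OF that] by (simp add: \<beta>_def field_simps)
    then have d_eq: "d = x - x * (x - 1)"
      by (simp add: algebra_simps)
    have "1 - d = (x - 1)\<^sup>2"
      unfolding d_eq by (simp add: power2_eq_square algebra_simps)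
    then show False
      using nsq by auto
  qed
  \<comment> \<open>Unlike \<open>\<alpha>\<close> and \<open>\<beta>\<close>, whose fixed points
    would make \<open>d\<close> or \<open>1 - d\<close> a square directly, here membership in
    \<open>X\<close> is needed: a fixed point makes \<open>f x\<close> a nonzero square times
    \<open>d\<close>.\<close>
  have \<gamma>_neq: "\<gamma> x \<noteq> x" if "x \<in> X" for x
  proof
    assume "\<gamma> x = x"
    then have "d * (x - 1) = x * (x - d)"
      using X[OF that] by (simp add: \<gamma>_def field_simps)
    moreover have "f x = (x - 1) * (x * (x - d))"
      by (simp add: f_def)
    ultimately have "f x = (x - 1)\<^sup>2 * d"
      by (simp add: power2_eq_square mult_ac)
    moreover have "is_square (f x)"
      using that by (simp add: X_def)
    ultimately show False
      using nsq X[OF that] by (simp add: is_square_cancel_left)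
  qed
  \<comment> \<open>Distinct translations differ by a third one, so a coincidence of two images
    would be a fixed point of that third map.\<close>
  have \<alpha>_neq_\<beta>: "\<alpha> x \<noteq> \<beta> x" if "x \<in> X" for x
    using \<gamma>_neq[OF that] \<gamma>_eq[OF that] \<alpha>_\<alpha>[OF that] by metis
  have \<alpha>_neq_\<gamma>: "\<alpha> x \<noteq> \<gamma> x" if "x \<in> X" for x
    using \<beta>_neq[OF \<alpha>_X[OF that]] \<gamma>_eq'[OF that] by metis
  have \<beta>_neq_\<gamma>: "\<beta> x \<noteq> \<gamma> x" if "x \<in> X" for x
    using \<alpha>_neq[OF \<beta>_X[OF that]] \<gamma>_eq[OF that] by metis
  define c where "c x = {x, \<alpha> x, \<beta> x, \<gamma> x}" for x
  have c_\<alpha>: "c (\<alpha> x) = c x" if "x \<in> X" for x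
    using \<alpha>_\<alpha>[OF that] \<gamma>_eq'[OF that] \<gamma>_eq[OF \<alpha>_X[OF that]] \<gamma>_eq[OF that] \<alpha>_\<alpha>[OF \<beta>_X[OF that]]
    by (auto simp: c_def)
  have c_\<beta>: "c (\<beta> x) = c x" if "x \<in> X" for x
    using \<beta>_\<beta>[OF that] \<gamma>_eq[OF that] \<gamma>_eq[OF \<beta>_X[OF that]] by (auto simp: c_def)
  have dvd: "4 dvd card X"
  proof (rule dvd_card_if_class_card[where c = c])
    show "x \<in> c x \<and> c x \<subseteq> X \<and> card (c x) = 4" if "x \<in> X" for x
      using that \<alpha>_X \<beta>_X \<gamma>_X \<alpha>_neq[OF that] \<beta>_neq[OF that] \<gamma>_neq[OF that]
        \<alpha>_neq_\<beta>[OF that] \<alpha>_neq_\<gamma>[OF that] \<beta>_neq_\<gamma>[OF that]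
      by (auto simp: c_def)
    show "c y = c x" if "x \<in> X" "y \<in> c x" for x y
    proof -
      have "c (\<gamma> x) = c x"
        using that by (simp add: \<gamma>_eq c_\<alpha> c_\<beta> \<beta>_X)
      moreover have "y = x \<or> y = \<alpha> x \<or> y = \<beta> x \<or> y = \<gamma> x"
        using that(2) by (simp add: c_def)
      ultimately show ?thesis
        using c_\<alpha>[OF that(1)] c_\<beta>[OF that(1)] by (elim disjE) (simp_all only:)
    qed
  qed simp
  \<comment> \<open>The 4 stands for infinity and the three points with \<open>y = 0\<close>; each
    element of \<open>X\<close> carries two points.\<close>
  have count: "int CARD('a) + 1 - legendre_trace d = 4 + 2 * int (card X)"
  proof -
    have "int CARD('a) - legendre_trace d = (\<Sum>x\<in>UNIV. 1 + quad_char (f x))"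
      by (simp add: legendre_trace_eq_sum[OF odd] f_def sum.distrib)
    also have "\<dots> = (\<Sum>x\<in>UNIV. (if x \<in> {0, 1, d} then 1 else 0) + (if x \<in> X then 2 else 0))"
      by (rule sum.cong) (auto simp: quad_char_def X_def f_def)
    also have "\<dots> = int (card {0, 1, d}) + 2 * int (card X)"
      by (simp add: sum.distrib sum.If_cases del: insert_iff)
    finally show ?thesis
      using d by simp
  qed
  from dvd obtain k where "card X = 4 * k"
    by (elim dvdE)
  then show ?thesis
    unfolding count by (simp add: cong_def)
qed

section \<open>Passing to square roots and the final count\<close>

lemma card_square_vimage:
  fixes D :: "'a::finite_field set"
  assumes "odd CARD('a)" "\<And>d. d \<in> D \<Longrightarrow> is_square d \<and> d \<noteq> 0"
  shows "card {e. e\<^sup>2 \<in> D} = 2 * card D"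
proof -
  have "{e. e\<^sup>2 \<in> D} = (\<Union>d\<in>D. {e. e\<^sup>2 = d})"
    by auto
  also have "card \<dots> = (\<Sum>d\<in>D. card {e. e\<^sup>2 = d})"
    by (rule card_UN_disjoint) auto
  also have "\<dots> = (\<Sum>d\<in>D. 2)"
    by (rule sum.cong) (auto simp: card_square_roots assms)
  finally show ?thesis
    by simp
qed

text \<open>If \<open>e\<^sup>2\<close> is the fourth power of \<open>y\<close>, then
  \<open>e\<close> is \<open>y\<^sup>2\<close> or its negative, and both are squares because -1
  is.\<close>

lemma square_is_fourth_power_iff:
  fixes e :: "'a::field"
  assumes "is_square (- 1 :: 'a)"
  shows "is_nth_power 4 (e\<^sup>2) \<longleftrightarrow> is_square e"
proof
  assume "is_nth_power 4 (e\<^sup>2)"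
  then obtain y where "e\<^sup>2 = (y\<^sup>2)\<^sup>2"
    by (auto simp: is_nth_power_def simp flip: power_mult)
  then have "e = y\<^sup>2 \<or> e = - 1 * y\<^sup>2"
    by (simp only: power2_eq_iff mult_minus1)
  moreover have "is_square (- 1 * y\<^sup>2)"
    using assms by (intro is_nth_power_mult) auto
  ultimately show "is_square e"
    by auto
next
  assume "is_square e"
  then show "is_nth_power 4 (e\<^sup>2)"
    by (auto simp: is_nth_power_def simp flip: power_mult)
qed

theorem theorem7p6:
  fixes q :: nat and A :: int
  assumes "primepow q" and "odd q" and "[q = 1] (mod 4)"
    and "CARD('a::finite_field) = q"
    and "[int q + 1 - A = 0] (mod 8)"
  shows "\<exists>f. bij_betw f (N2n4 A :: 'a set) (Nn2 A :: 'a set)"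
proof -
  have odd: "odd CARD('a)" and m1: "is_square (- 1 :: 'a)"
    using assms is_square_uminus_one[where 'a = 'a] by auto
  have two: "(2::'a) \<noteq> 0"
    by (rule two_neq_zero[OF odd])
  define D :: "'a set"
    where "D = {d. d \<notin> {0, 1} \<and> legendre_trace d = A \<and> is_square d \<and> \<not> is_square (1 - d)}"
  define h :: "'a \<Rightarrow> 'a" where "h e = (1 - e) / (1 + e)" for e
  \<comment> \<open>Otherwise the point count would be 4 modulo 8, while the hypothesis on
    \<open>A\<close> makes it 0.\<close>
  have square_one_minus: "is_square (1 - d)" if "d \<in> Nn2 A" for d :: 'a
  proof (rule ccontr)
    assume "\<not> is_square (1 - d)"
    then have "[int q + 1 - A = 4] (mod 8)"
      using that card_legendre_curve_mod_8[OF odd, of d] assms(4) by (simp add: Nn2_def)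
    then show False
      using assms(5) by (simp add: cong_def)
  qed
  have "bij_betw (\<lambda>d. 1 - d) D (Nn2 A)"
  proof (rule bij_betwI[where g = "\<lambda>d. 1 - d"])
    show "(\<lambda>d. 1 - d) \<in> D \<rightarrow> Nn2 A"
      by (auto simp: D_def Nn2_def legendre_trace_one_minus[OF odd m1])
    show "(\<lambda>d. 1 - d) \<in> Nn2 A \<rightarrow> D"
      using square_one_minus by (auto simp: D_def Nn2_def legendre_trace_one_minus[OF odd m1])
  qed auto
  then have "card D = card (Nn2 A :: 'a set)"
    by (rule bij_betw_same_card)
  \<comment> \<open>The comparison takes place on roots because \<open>h\<close> does not descend to
    squares: \<open>h (- e)\<close> is the inverse of \<open>h e\<close>, not its negative.\<close>
  moreover have "card {e. e\<^sup>2 \<in> D} = card {e::'a. e\<^sup>2 \<in> N2n4 A}"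
  proof -
    have D_iff: "e\<^sup>2 \<in> D \<longleftrightarrow> e \<notin> {0, 1, - 1} \<and> legendre_trace (e\<^sup>2) = A \<and> \<not> is_square (h e)" for e
    \<comment> \<open>At the pole \<open>e = - 1\<close> of \<open>h\<close> the value of the
      division is irrelevant: \<open>e\<^sup>2 = 1\<close> makes both sides false.\<close>
    proof (cases "1 + e = 0")
      case True
      then have "e = - 1"
        by (simp add: eq_neg_iff_add_eq_0 add.commute)
      then show ?thesis
        by (simp add: D_def)
    next
      case False
      then have "1 - e\<^sup>2 = (1 + e)\<^sup>2 * h e"
        by (simp add: h_def field_simps power2_eq_square)
      then have "is_square (1 - e\<^sup>2) \<longleftrightarrow> is_square (h e)"
        using False by (simp add: is_square_cancel_left)
      then show ?thesis
        by (auto simp: D_def power2_eq_1_iff)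
    qed
    have N_iff: "e\<^sup>2 \<in> N2n4 A \<longleftrightarrow> e \<notin> {0, 1, - 1} \<and> legendre_trace (e\<^sup>2) = A \<and> \<not> is_square e"
      for e :: 'a
      by (auto simp: N2n4_def power2_eq_1_iff square_is_fourth_power_iff[OF m1])
    have h: "h e \<notin> {0, 1, - 1} \<and> h (h e) = e \<and> legendre_trace ((h e)\<^sup>2) = legendre_trace (e\<^sup>2)"
      if "e \<notin> {0, 1, - 1}" for e
    proof -
      have e: "e \<noteq> 0" "e \<noteq> 1" "1 + e \<noteq> 0"
        using that by (auto simp: add_eq_0_iff)
      have "h e \<noteq> 1"
      proof
        assume "h e = 1"
        then have "1 - e = 1 + e"
          using e by (simp add: h_def)
        then have "(1 + e) - (1 - e) = 0"
          by simp
        then have "2 * e = 0"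
          by simp
        then show False
          using e two by simp
      qed
      moreover have "h e + 1 = 2 / (1 + e)"
        using e by (simp add: h_def field_simps)
      then have 1: "1 + h e = 2 / (1 + e)"
        by (simp add: add.commute)
      then have "h e \<noteq> - 1"
        using e two by auto
      moreover have "1 - h e = 2 * e / (1 + e)"
        using e by (simp add: h_def field_simps)
      then have "h (h e) = e"
        unfolding h_def[of "h e"] 1 using e two by simp
      ultimately show ?thesis
        using e legendre_trace_two_isogeny[OF odd m1] by (simp add: h_def)
    qed
    have "bij_betw h {e. e\<^sup>2 \<in> D} {e. e\<^sup>2 \<in> N2n4 A}"
      unfolding D_iff N_iff by (rule bij_betwI[where g = h]) (use h in auto)
    then show ?thesis
      by (rule bij_betw_same_card)
  qed
  moreover have "card {e. e\<^sup>2 \<in> D} = 2 * card D"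
    by (rule card_square_vimage[OF odd]) (simp add: D_def)
  moreover have "card {e::'a. e\<^sup>2 \<in> N2n4 A} = 2 * card (N2n4 A :: 'a set)"
    by (rule card_square_vimage[OF odd]) (simp add: N2n4_def)
  ultimately have "card (N2n4 A :: 'a set) = card (Nn2 A :: 'a set)"
    by simp
  then show ?thesis
    by (intro finite_same_card_bij) auto
qed

end
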